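(* If $G$ is a maximal outerplanar graph of order $n\geq 3$, then $$\mathrm{fd}(G)\leq\frac{7n-3}{8}<\frac{7n}{8}.$$
   Context: All graphs are finite and simple. A maximal outerplanar graph (MOP) of order $n\ge 3$ is a triangulation of a convex $n$-gon: its vertices are the $n$ corners of the polygon, and its edges are the $n$ sides of the polygon together with a maximal set of pairwise non-crossing diagonals ($n-3$ of them). For a vertex $v$ of a graph $G=(V,E)$, $N(v)$ denotes its open neighborhood. A set $D\subseteq V$ is a dominating set if every vertex outside $D$ has a neighbor in $D$. A dominating set $D$ is a fair dominating set (FD-set) if $|N(u)\cap D|=|N(v)\cap D|$ for every two vertices $u,v\in V\setminus D$ (in particular $D=V$ is an FD-set). The fair domination number $\mathrm{fd}(G)$ is the minimum cardinality of an FD-set of $G$. *)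

theory Defs
  imports "HOL-Analysis.Analysis"
begin

definition simple_graph :: "'a set \<Rightarrow> 'a set set \<Rightarrow> bool" where
  "simple_graph V E \<longleftrightarrow> finite V \<and> (\<forall>e\<in>E. e \<subseteq> V \<and> card e = 2)"

definition neighborhood :: "'a set \<Rightarrow> 'a set set \<Rightarrow> 'a \<Rightarrow> 'a set" where
  "neighborhood V E v = {u \<in> V. {u, v} \<in> E}"

definition dominating_set :: "'a set \<Rightarrow> 'a set set \<Rightarrow> 'a set \<Rightarrow> bool" where
  "dominating_set V E D \<longleftrightarrow> D \<subseteq> V \<and> (\<forall>v \<in> V - D. \<exists>u \<in> D. u \<in> neighborhood V E v)"

definition fair_dominating_set :: "'a set \<Rightarrow> 'a set set \<Rightarrow> 'a set \<Rightarrow> bool" where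
  "fair_dominating_set V E D \<longleftrightarrow> dominating_set V E D \<and>
     (\<forall>u \<in> V - D. \<forall>v \<in> V - D.
        card (neighborhood V E u \<inter> D) = card (neighborhood V E v \<inter> D))"

definition fair_domination_number :: "'a set \<Rightarrow> 'a set set \<Rightarrow> nat" where
  "fair_domination_number V E = (LEAST k. \<exists>D. fair_dominating_set V E D \<and> card D = k)"

(* The corners p 0, ..., p (n - 1) of a convex n-gon, listed counterclockwise, with the plane
   as the complex numbers: the imaginary part below is twice the signed area of the triangle
   p i, p j, p k. Strictness means that no corner is degenerate. *)
definition convex_polygon :: "nat \<Rightarrow> (nat \<Rightarrow> complex) \<Rightarrow> bool" where
  "convex_polygon n p \<longleftrightarrow> n \<ge> 3 \<and>
     (\<forall>i j k. i < j \<and> j < k \<and> k < n \<longrightarrow> Im (cnj (p j - p i) * (p k - p i)) > 0)"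

(* Sides and diagonals are given as sets of two corner indices. *)
definition polygon_sides :: "nat \<Rightarrow> nat set set" where
  "polygon_sides n = {{i, Suc i mod n} | i. i < n}"

definition polygon_diagonals :: "nat \<Rightarrow> nat set set" where
  "polygon_diagonals n = {{i, j} | i j. i < n \<and> j < n \<and> i \<noteq> j} - polygon_sides n"

(* Segments are open, so diagonals that share only a corner do not cross. *)
definition crossing :: "(nat \<Rightarrow> complex) \<Rightarrow> nat set \<Rightarrow> nat set \<Rightarrow> bool" where
  "crossing p e f \<longleftrightarrow> (\<exists>i j k l. e = {i, j} \<and> f = {k, l} \<and>
     open_segment (p i) (p j) \<inter> open_segment (p k) (p l) \<noteq> {})"

definition noncrossing_diagonals :: "nat \<Rightarrow> (nat \<Rightarrow> complex) \<Rightarrow> nat set set \<Rightarrow> bool" where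
  "noncrossing_diagonals n p T \<longleftrightarrow>
     T \<subseteq> polygon_diagonals n \<and> pairwise (\<lambda>e f. \<not> crossing p e f) T"

definition triangulating_diagonals :: "nat \<Rightarrow> (nat \<Rightarrow> complex) \<Rightarrow> nat set set \<Rightarrow> bool" where
  "triangulating_diagonals n p T \<longleftrightarrow> noncrossing_diagonals n p T \<and>
     (\<forall>T'. noncrossing_diagonals n p T' \<and> T \<subseteq> T' \<longrightarrow> T' = T)"

(* As an abstract graph: c names the polygon's corners by the vertices of the graph. *)
definition maximal_outerplanar :: "'a set \<Rightarrow> 'a set set \<Rightarrow> bool" where
  "maximal_outerplanar V E \<longleftrightarrow> simple_graph V E \<and>
     (\<exists>p c T. convex_polygon (card V) p \<and> bij_betw c {..<card V} V \<and>
        triangulating_diagonals (card V) p T \<and>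
        E = (\<lambda>e. c ` e) ` (polygon_sides (card V) \<union> T))"

end

(* We look for a set S, the complement of the FD-set, such that every vertex of S has exactly two
   neighbours outside S and 8 |S| >= n + 3. Every diagonal or side {i, j} cuts off the part of the
   graph on the corners i, ..., j. Record for such a part, and for each way S can meet i and j
   together with the number of neighbours outside S that i and j already have strictly between
   them, how large S can be, normalised so that every vertex strictly between i and j costs 1 and
   every such vertex of S earns 8. Gluing two parts along a triangle combines two such records.
   There are fifteen tables of lower bounds such that, whenever the two parts each satisfy one of
   the tables (or consist of a single side), their gluing satisfies one of the tables again; each
   table contains a bound that gives the claim for the whole polygon. *)
theory Submission
  imports Defs
begin

section \<open>Orientation of point triples and intersection of open segments\<close>

definition orient :: "complex \<Rightarrow> complex \<Rightarrow> complex \<Rightarrow> real" where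
  "orient a b c = Im (cnj (b - a) * (c - a))"

lemma orient_affine:
  "orient a b ((1 - t) *\<^sub>R c + t *\<^sub>R d) = (1 - t) * orient a b c + t * orient a b d"
  by (simp add: orient_def algebra_simps)

lemma orient_rotate: "orient b c a = orient a b c"
  by (simp add: orient_def algebra_simps)

lemma orient_swap: "orient a c b = - orient a b c"
  by (simp add: orient_def algebra_simps)

lemma orient_degenerate [simp]: "orient a b a = 0" "orient a b b = 0"
  by (simp_all add: orient_def algebra_simps)

lemma orient_open_segment:
  assumes "z \<in> open_segment a b"
  shows "orient a b z = 0"
  using assms by (auto simp: in_segment orient_affine)

lemma orient_pos_open_segment:
  assumes "z \<in> open_segment c d" "orient a b c \<ge> 0" "orient a b d \<ge> 0"
    and "orient a b c > 0 \<or> orient a b d > 0"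
  shows "orient a b z > 0"
proof -
  obtain t where t: "0 < t" "t < 1" "z = (1 - t) *\<^sub>R c + t *\<^sub>R d"
    using assms(1) by (auto simp: in_segment)
  have "(1 - t) * orient a b c \<ge> 0" "t * orient a b d \<ge> 0"
    using t assms(2,3) by simp_all
  moreover have "(1 - t) * orient a b c > 0 \<or> t * orient a b d > 0"
    using t assms(4) by auto
  ultimately show ?thesis
    unfolding t(3) orient_affine by linarith
qed

text \<open>Each segment has its ends strictly on opposite sides of the line through the other. So
  \<open>c d\<close> meets the line through \<open>a\<close> and \<open>b\<close>, and the position
  of \<open>a\<close> and \<open>b\<close> about the line \<open>c d\<close> puts that point between
  them.\<close>

lemma open_segments_meet:
  assumes k: "orient a b c < 0" and l: "orient a b d > 0"
    and i: "orient c d a > 0" and j: "orient c d b < 0"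
  shows "open_segment a b \<inter> open_segment c d \<noteq> {}"
proof -
  have ne: "a \<noteq> b" "c \<noteq> d"
    using k i by (auto simp: orient_def)
  \<comment> \<open>The parameter at which the affine function \<open>orient a b\<close> vanishes
    along \<open>c d\<close>.\<close>
  define t where "t = orient a b c / (orient a b c - orient a b d)"
  define z where "z = (1 - t) *\<^sub>R c + t *\<^sub>R d"
  have t: "0 < t" "t < 1"
    using k l by (auto simp: t_def field_simps)
  have zcd: "z \<in> open_segment c d"
    using t ne unfolding in_segment z_def by blast
  have "orient a b z = (1 - t) * orient a b c + t * orient a b d"
    unfolding z_def by (rule orient_affine)
  also have "\<dots> = 0"
    using k l by (simp add: t_def field_simps)
  finally have "orient a b z = 0" .
  \<comment> \<open>Zero orientation makes this quotient real, so \<open>z\<close> lies on the line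
    through \<open>a\<close> and \<open>b\<close>.\<close>
  then have im: "Im ((z - a) / (b - a)) = 0"
    by (simp add: orient_def Im_divide algebra_simps)
  define s where "s = Re ((z - a) / (b - a))"
  have "(z - a) / (b - a) = of_real s"
    using im by (simp add: s_def complex_eq_iff)
  then have zs: "z = (1 - s) *\<^sub>R a + s *\<^sub>R b"
    using ne by (simp add: field_simps scaleR_conv_of_real)
  have eq: "(1 - s) * orient c d a + s * orient c d b = 0"
    using orient_open_segment[OF zcd] unfolding zs orient_affine .
  have "s > 0"
  proof (rule ccontr)
    assume "\<not> s > 0"
    then have "(1 - s) * orient c d a > 0" "s * orient c d b \<ge> 0"
      using i j by (auto intro: mult_pos_pos mult_nonpos_nonpos)
    then show False using eq by linarith
  qed
  moreover have "s < 1"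
  proof (rule ccontr)
    assume "\<not> s < 1"
    then have "(1 - s) * orient c d a \<le> 0" "s * orient c d b < 0"
      using i j by (auto intro: mult_nonpos_nonneg mult_pos_neg)
    then show False using eq by linarith
  qed
  ultimately have "z \<in> open_segment a b"
    using ne zs unfolding in_segment by blast
  then show ?thesis using zcd by blast
qed

section \<open>Crossing of polygon chords in terms of the order of corners\<close>

definition interleaved :: "nat \<Rightarrow> nat \<Rightarrow> nat \<Rightarrow> nat \<Rightarrow> bool" where
  "interleaved i j k l \<longleftrightarrow> i < k \<and> k < j \<and> j < l \<or> k < i \<and> i < l \<and> l < j"

lemma crossing_iff:
  "crossing p {i, j} {k, l} \<longleftrightarrow> open_segment (p i) (p j) \<inter> open_segment (p k) (p l) \<noteq> {}"
proof
  assume "crossing p {i, j} {k, l}"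
  then obtain i' j' k' l' where e: "{i, j} = {i', j'}" "{k, l} = {k', l'}"
    and ne: "open_segment (p i') (p j') \<inter> open_segment (p k') (p l') \<noteq> {}"
    unfolding crossing_def by blast
  have "open_segment (p i') (p j') = open_segment (p i) (p j)"
    "open_segment (p k') (p l') = open_segment (p k) (p l)"
    using e by (auto simp: doubleton_eq_iff open_segment_commute)
  then show "open_segment (p i) (p j) \<inter> open_segment (p k) (p l) \<noteq> {}"
    using ne by metis
qed (unfold crossing_def, blast)

lemma crossing_commute: "crossing p e f \<longleftrightarrow> crossing p f e"
  unfolding crossing_def by (metis Int_commute)

context
  fixes n p
  assumes conv: "convex_polygon n p"
begin

lemma orient_pos:
  assumes "i < j" "j < k" "k < n"
  shows "orient (p i) (p j) (p k) > 0"
  using conv assms by (simp add: convex_polygon_def orient_def)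

lemma orient_between_neg:
  assumes "i < k" "k < j" "j < n"
  shows "orient (p i) (p j) (p k) < 0"
  using orient_pos[OF assms] orient_swap[of "p i" "p j" "p k"] by simp

lemma orient_before_pos:
  assumes "k < i" "i < j" "j < n"
  shows "orient (p i) (p j) (p k) > 0"
  using orient_pos[OF assms] orient_rotate[of "p i" "p j" "p k"] by simp

text \<open>By convexity each chord strictly separates the ends of the other.\<close>

lemma crossing_if_interleaved:
  assumes "i < k" "k < j" "j < l" "l < n"
  shows "crossing p {i, j} {k, l}"
  unfolding crossing_iff
proof (rule open_segments_meet)
  show "orient (p i) (p j) (p k) < 0" "orient (p i) (p j) (p l) > 0"
    using assms by (auto intro: orient_between_neg orient_pos)
  show "orient (p k) (p l) (p i) > 0" "orient (p k) (p l) (p j) < 0"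
    using assms by (auto intro: orient_between_neg orient_before_pos)
qed

lemma not_crossing_if_not_interleaved:
  assumes ij: "i < j" "j < n" and kl: "k < l" "l < n"
    and ne: "(i, j) \<noteq> (k, l)" and no: "\<not> interleaved i j k l"
  shows "\<not> crossing p {i, j} {k, l}"
proof
  assume "crossing p {i, j} {k, l}"
  then obtain z where z: "z \<in> open_segment (p i) (p j)" "z \<in> open_segment (p k) (p l)"
    unfolding crossing_iff by blast
  \<comment> \<open>The line through \<open>p i\<close> and \<open>p j\<close> has \<open>p k\<close> and \<open>p l\<close> weakly on the same side, not both on it.\<close>
  let ?f = "orient (p i) (p j)"
  let ?g = "orient (p j) (p i)"
  have f0: "?f z = 0" "?g z = 0"
    using z(1) by (auto intro: orient_open_segment simp: open_segment_commute)
  have fg: "?g x = - ?f x" for x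
    by (simp add: orient_def algebra_simps)
  have inside: "?f (p m) \<le> 0 \<and> (i < m \<and> m < j \<longrightarrow> ?f (p m) < 0)" if "i \<le> m" "m \<le> j" for m
    using that ij orient_between_neg[of i m j] by (cases "m = i \<or> m = j") auto
  have outside: "?f (p m) \<ge> 0 \<and> (m < i \<or> j < m \<longrightarrow> ?f (p m) > 0)"
    if "m \<le> i \<or> j \<le> m" "m < n" for m
    using that ij orient_before_pos[of m i j] orient_pos[of i j m]
    by (cases "m = i \<or> m = j") force+
  \<comment> \<open>Both ends of the second chord lie in the range from \<open>i\<close> to
    \<open>j\<close>, or neither lies strictly inside it. As the chords differ, some end avoids
    \<open>i\<close> and \<open>j\<close>, which makes the sign strict.\<close>
  consider "i \<le> k" "l \<le> j" "i < k \<or> l < j" | "k \<le> i \<or> j \<le> k" "l \<le> i \<or> j \<le> l"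
      "k < i \<or> j < k \<or> l < i \<or> j < l"
    using ij kl ne no unfolding interleaved_def by fastforce
  then show False
  proof cases
    case 1
    then have "?g z > 0"
      using inside[of k] inside[of l] kl
      by (intro orient_pos_open_segment[OF z(2)]) (auto simp: fg)
    then show False using f0 by simp
  next
    case 2
    then have "?f z > 0"
      using outside[of k] outside[of l] kl
      by (intro orient_pos_open_segment[OF z(2)]) auto
    then show False using f0 by simp
  qed
qed

end

section \<open>From geometric to combinatorial triangulations\<close>

lemma polygon_sides_iff:
  assumes "i < j" "j < n"
  shows "{i, j} \<in> polygon_sides n \<longleftrightarrow> j = Suc i \<or> i = 0 \<and> j = n - 1"
proof
  assume "{i, j} \<in> polygon_sides n"
  then obtain m where m: "m < n" "{i, j} = {m, Suc m mod n}"
    by (auto simp: polygon_sides_def)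
  show "j = Suc i \<or> i = 0 \<and> j = n - 1"
    using m assms by (cases "Suc m = n") (auto simp: doubleton_eq_iff)
next
  assume "j = Suc i \<or> i = 0 \<and> j = n - 1"
  then show "{i, j} \<in> polygon_sides n"
  proof
    assume "j = Suc i"
    then have "{i, j} = {i, Suc i mod n}" using assms by simp
    then show ?thesis using assms unfolding polygon_sides_def
      by (intro CollectI exI[of _ i]) simp
  next
    assume "i = 0 \<and> j = n - 1"
    then have "{i, j} = {j, Suc j mod n}" using assms by auto
    then show ?thesis using assms unfolding polygon_sides_def
      by (intro CollectI exI[of _ j]) simp
  qed
qed

text \<open>Isolates what the counting argument uses, in terms of indices alone. Edges are
  unordered, so each assumption also applies with the two ends exchanged; \<open>saturated\<close>
  expresses maximality.\<close>

locale triangulated_polygon =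
  fixes n :: nat and G :: "nat set set"
  assumes edge_less: "{i, j} \<in> G \<Longrightarrow> j < n"
    and no_loop: "{i} \<notin> G"
    and noncrossing: "\<lbrakk>{i, j} \<in> G; {k, l} \<in> G; i < k; k < j\<rbrakk> \<Longrightarrow> l \<le> j"
    and saturated: "\<lbrakk>i < j; j < n; \<And>k l. \<lbrakk>{k, l} \<in> G; k < l\<rbrakk> \<Longrightarrow> \<not> interleaved i j k l\<rbrakk> \<Longrightarrow> {i, j} \<in> G"

lemma triangulating_diagonals_imp_triangulated_polygon:
  assumes conv: "convex_polygon n p" and tri: "triangulating_diagonals n p T"
  shows "triangulated_polygon n (polygon_sides n \<union> T)"
proof
  have n3: "n \<ge> 3" using conv by (simp add: convex_polygon_def)
  have TD: "T \<subseteq> polygon_diagonals n" and pw: "pairwise (\<lambda>e f. \<not> crossing p e f) T"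
    and max: "\<And>T'. noncrossing_diagonals n p T' \<Longrightarrow> T \<subseteq> T' \<Longrightarrow> T' = T"
    using tri by (auto simp: triangulating_diagonals_def noncrossing_diagonals_def)
  let ?G = "polygon_sides n \<union> T"
  have shape: "\<exists>i j. e = {i, j} \<and> i < j \<and> j < n" if e: "e \<in> ?G" for e
  proof -
    have "\<exists>i j. e = {i, j} \<and> i < n \<and> j < n \<and> i \<noteq> j"
    proof (cases "e \<in> T")
      case True
      then show ?thesis using TD by (auto simp: polygon_diagonals_def)
    next
      case False
      then obtain m where m: "m < n" "e = {m, Suc m mod n}"
        using e by (auto simp: polygon_sides_def)
      have "m \<noteq> Suc m mod n" using m n3 by (cases "Suc m = n") auto
      then show ?thesis using m n3 by (intro exI[of _ m] exI[of _ "Suc m mod n"]) auto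
    qed
    then obtain i j where "e = {i, j}" "i < n" "j < n" "i \<noteq> j" by blast
    then show ?thesis by (metis insert_commute linorder_neqE_nat)
  qed
  show less: "j < n" if "{i, j} \<in> ?G" for i j
    using shape[OF that] by (auto simp: doubleton_eq_iff)
  show "{i} \<notin> ?G" for i
    using shape[of "{i}"] by (auto simp: singleton_insert_inj_eq')
  show "l \<le> j" if e: "{i, j} \<in> ?G" and f: "{k, l} \<in> ?G" and lt: "i < k" "k < j" for i j k l
  proof (rule ccontr)
    assume "\<not> l \<le> j"
    then have jl: "j < l" by simp
    have ln: "l < n" using less[OF f] .
    \<comment> \<open>The ends of a side are cyclically adjacent, so neither of two interleaved
      chords can be a side.\<close>
    have "{i, j} \<in> T" "{k, l} \<in> T"
      using e f lt jl ln polygon_sides_iff[of i j n] polygon_sides_iff[of k l n] by auto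
    moreover have "{i, j} \<noteq> {k, l}" using lt jl by (auto simp: doubleton_eq_iff)
    ultimately have "\<not> crossing p {i, j} {k, l}"
      using pw by (auto simp: pairwise_def)
    then show False
      using crossing_if_interleaved[OF conv lt jl ln] by simp
  qed
  show "{i, j} \<in> ?G"
    if ij: "i < j" "j < n" and no: "\<And>k l. \<lbrakk>{k, l} \<in> ?G; k < l\<rbrakk> \<Longrightarrow> \<not> interleaved i j k l" for i j
  proof (rule ccontr)
    assume nin: "{i, j} \<notin> ?G"
    have diag: "{i, j} \<in> polygon_diagonals n"
      using nin ij unfolding polygon_diagonals_def by fastforce
    have nc: "\<not> crossing p {i, j} f" if f: "f \<in> T" for f
    proof -
      obtain k l where kl: "f = {k, l}" "k < l" "l < n" using shape f by blast
      have "(i, j) \<noteq> (k, l)" using nin kl f by auto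
      moreover have "\<not> interleaved i j k l" using no[of k l] kl f by blast
      ultimately show ?thesis
        using not_crossing_if_not_interleaved[OF conv ij kl(2,3)] kl(1) by blast
    qed
    have "noncrossing_diagonals n p (insert {i, j} T)"
      unfolding noncrossing_diagonals_def pairwise_insert
      using TD pw diag nc by (auto simp: crossing_commute[of p _ "{i, j}"])
    from max[OF this] show False using nin by blast
  qed
qed

section \<open>Records for the parts cut off by chords, and their gluing\<close>

text \<open>In an entry \<open>(s, t, w)\<close> for a chord \<open>{i, j}\<close>, \<open>s\<close> and \<open>t\<close> describe \<open>i\<close> and \<open>j\<close>: \<open>None\<close> means that
  the corner lies outside \<open>S\<close>, and \<open>Some c\<close> that it lies in \<open>S\<close> and has \<open>c\<close> neighbours outside \<open>S\<close>
  strictly between \<open>i\<close> and \<open>j\<close> (so the opposite end of the chord is not counted). The number \<open>w\<close> is a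
  lower bound for eight times the number of corners of \<open>S\<close> strictly between \<open>i\<close> and \<open>j\<close>, minus the
  number \<open>j - i - 1\<close> of all corners there.\<close>

type_synonym entry = "nat option \<times> nat option \<times> int"

text \<open>The middle statuses belong to the common apex. Outside \<open>S\<close> it costs 1 and
  is one more neighbour outside \<open>S\<close> for each end. Inside \<open>S\<close> it
  contributes 8 - 1 = 7, and its two neighbours outside \<open>S\<close> are counted from both parts
  and from the ends lying outside \<open>S\<close>.\<close>

fun glue :: "entry \<Rightarrow> entry \<Rightarrow> entry option" where
  "glue (s, None, w) (None, t, w') = Some (map_option Suc s, map_option Suc t, w + w' - 1)"
| "glue (s, Some x, w) (Some y, t, w') =
     (if x + y + of_bool (s = None) + of_bool (t = None) = 2 then Some (s, t, w + w' + 7) else None)"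
| "glue _ _ = None"

context triangulated_polygon
begin

definition dominators :: "nat set \<Rightarrow> nat set \<Rightarrow> nat \<Rightarrow> nat" where
  "dominators S A v = (\<Sum>u\<in>A. of_bool (u \<notin> S \<and> {u, v} \<in> G))"

definition status :: "nat set \<Rightarrow> nat set \<Rightarrow> nat \<Rightarrow> nat option" where
  "status S A v = (if v \<in> S then Some (dominators S A v) else None)"

text \<open>The ends are exempt from the condition of two neighbours, since parts glued on later may
  add some. The final \<open>+ 1\<close> comes from moving \<open>j - i - 1\<close> across the
  inequality, which avoids truncated subtraction.\<close>

definition achieves :: "nat \<Rightarrow> nat \<Rightarrow> entry \<Rightarrow> bool" where
  "achieves i j e \<longleftrightarrow> (\<exists>S \<subseteq> {i..j}. (case e of (s, t, w) \<Rightarrow>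
     status S {i<..<j} i = s \<and> status S {i<..<j} j = t \<and>
     (\<forall>v \<in> S \<inter> {i<..<j}. dominators S {i..j} v = 2) \<and>
     w + int (j - i) \<le> 8 * int (card (S \<inter> {i<..<j})) + 1))"

lemma dominators_cong:
  assumes "A = B" "\<And>u. u \<in> B \<Longrightarrow> u \<in> S \<longleftrightarrow> u \<in> S'"
  shows "dominators S A v = dominators S' B v"
  using assms by (simp add: dominators_def)

lemma dominators_Un:
  assumes "finite A" "finite B" "A \<inter> B = {}"
  shows "dominators S (A \<union> B) v = dominators S A v + dominators S B v"
  unfolding dominators_def using assms by (rule sum.union_disjoint)

lemma dominators_insert:
  assumes "finite A" "a \<notin> A"
  shows "dominators S (insert a A) v = of_bool (a \<notin> S \<and> {a, v} \<in> G) + dominators S A v"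
  using assms by (simp add: dominators_def)

lemma dominators_eq_0:
  assumes "\<And>u. u \<in> A \<Longrightarrow> {u, v} \<notin> G"
  shows "dominators S A v = 0"
  using assms by (simp add: dominators_def)

text \<open>The edges at the apex \<open>k\<close> separate the two parts, so the counts at their
  inner corners do not change; only \<open>i\<close>, \<open>j\<close> and \<open>k\<close> have to
  be recounted.\<close>

lemma achieves_glue:
  assumes ik: "i < k" "k < j" and edges: "{i, j} \<in> G" "{i, k} \<in> G" "{k, j} \<in> G"
    and L: "achieves i k e1" and R: "achieves k j e2" and gl: "glue e1 e2 = Some e"
  shows "achieves i j e"
proof -
  obtain s c w where e1: "e1 = (s, c, w)" by (cases e1)
  obtain c' t w' where e2: "e2 = (c', t, w')" by (cases e2)
  obtain S1 where S1: "S1 \<subseteq> {i..k}" "status S1 {i<..<k} i = s" "status S1 {i<..<k} k = c"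
    "\<And>v. v \<in> S1 \<Longrightarrow> v \<in> {i<..<k} \<Longrightarrow> dominators S1 {i..k} v = 2"
    "w + int (k - i) \<le> 8 * int (card (S1 \<inter> {i<..<k})) + 1"
    using L unfolding achieves_def e1 by auto
  obtain S2 where S2: "S2 \<subseteq> {k..j}" "status S2 {k<..<j} k = c'" "status S2 {k<..<j} j = t"
    "\<And>v. v \<in> S2 \<Longrightarrow> v \<in> {k<..<j} \<Longrightarrow> dominators S2 {k..j} v = 2"
    "w' + int (j - k) \<le> 8 * int (card (S2 \<inter> {k<..<j})) + 1"
    using R unfolding achieves_def e2 by auto
  have c_iff: "(c = None) = (c' = None)"
    using gl unfolding e1 e2 by (cases c; cases c') auto
  have k_iff: "k \<in> S1 \<longleftrightarrow> k \<in> S2"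
    using c_iff S1(3) S2(2) by (auto simp: status_def split: if_splits)
  \<comment> \<open>Both sets agree at \<open>k\<close>, hence the union restricts to
    \<open>S1\<close> up to \<open>k\<close> and to \<open>S2\<close> from \<open>k\<close>
    on.\<close>
  define S where "S = S1 \<union> S2"
  have SL: "u \<in> S \<longleftrightarrow> u \<in> S1" if "u \<le> k" for u
    using that S2(1) k_iff by (cases "u = k") (auto simp: S_def)
  have SR: "u \<in> S \<longleftrightarrow> u \<in> S2" if "k \<le> u" for u
    using that S1(1) k_iff by (cases "u = k") (auto simp: S_def)
  have SLD: "dominators S A v = dominators S1 A v" if "A \<subseteq> {..k}" for A v
    using that SL by (intro dominators_cong) auto
  have SRD: "dominators S A v = dominators S2 A v" if "A \<subseteq> {k..}" for A v
    using that SR by (intro dominators_cong) auto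
  have sym: "{u, v} \<in> G \<longleftrightarrow> {v, u} \<in> G" for u v by (simp add: insert_commute)
  \<comment> \<open>Such an edge would cross \<open>{k, j}\<close> if \<open>u = i\<close>, and
    \<open>{i, k}\<close> otherwise.\<close>
  have no_LR: "{u, v} \<notin> G" if "i \<le> u" "u < k" "k < v" "v \<le> j" "(u, v) \<noteq> (i, j)" for u v
  proof (cases "u = i")
    case True
    then show ?thesis using noncrossing[of i v k j] edges ik that by force
  next
    case False
    then show ?thesis using noncrossing[of i k u v] edges ik that by force
  qed
  have split: "{i<..<j} = insert k ({i<..<k} \<union> {k<..<j})" using ik by auto
  have dom_split: "dominators S {i<..<j} v =
      of_bool (k \<notin> S \<and> {k, v} \<in> G) + dominators S1 {i<..<k} v + dominators S2 {k<..<j} v" for v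
  proof -
    have "{i<..<k} \<inter> {k<..<j} = {}" by auto
    then have "dominators S {i<..<j} v =
        of_bool (k \<notin> S \<and> {k, v} \<in> G) + (dominators S {i<..<k} v + dominators S {k<..<j} v)"
      unfolding split by (simp add: dominators_insert dominators_Un)
    moreover have "dominators S {i<..<k} v = dominators S1 {i<..<k} v"
      "dominators S {k<..<j} v = dominators S2 {k<..<j} v"
      by (auto intro!: SLD SRD)
    ultimately show ?thesis by simp
  qed
  have "dominators S2 {k<..<j} i = 0"
    using no_LR[of i] ik by (intro dominators_eq_0) (auto simp: sym[of _ i])
  then have dom_i: "dominators S {i<..<j} i = of_bool (k \<notin> S) + dominators S1 {i<..<k} i"
    using edges ik by (simp add: dom_split sym[of k i])
  have "dominators S1 {i<..<k} j = 0"
    using no_LR[of _ j] ik by (intro dominators_eq_0) auto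
  then have dom_j: "dominators S {i<..<j} j = of_bool (k \<notin> S) + dominators S2 {k<..<j} j"
    using edges ik by (simp add: dom_split)
  have full: "{i..j} = insert i (insert j {i<..<j})" using ik by auto
  have dom_k: "dominators S {i..j} k = of_bool (i \<notin> S) + of_bool (j \<notin> S)
      + dominators S1 {i<..<k} k + dominators S2 {k<..<j} k"
    using edges ik no_loop[of k]
    by (simp add: full dominators_insert dom_split sym[of j k])
  have dom_L: "dominators S {i..j} v = dominators S1 {i..k} v" if "i < v" "v < k" for v
  proof -
    have "{i..j} = {i..k} \<union> {k<..j}" "{i..k} \<inter> {k<..j} = {}" using ik by auto
    then have "dominators S {i..j} v = dominators S {i..k} v + dominators S {k<..j} v"
      by (simp add: dominators_Un)
    moreover have "dominators S {k<..j} v = 0"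
      using that by (intro dominators_eq_0) (auto simp: no_LR sym[of _ v])
    ultimately show ?thesis by (simp add: SLD)
  qed
  have dom_R: "dominators S {i..j} v = dominators S2 {k..j} v" if "k < v" "v < j" for v
  proof -
    have "{i..j} = {i..<k} \<union> {k..j}" "{i..<k} \<inter> {k..j} = {}" using ik by auto
    then have "dominators S {i..j} v = dominators S {i..<k} v + dominators S {k..j} v"
      by (simp add: dominators_Un)
    moreover have "dominators S {i..<k} v = 0"
      using that by (intro dominators_eq_0) (auto simp: no_LR)
    ultimately show ?thesis by (simp add: SRD)
  qed
  have S_sub: "S \<subseteq> {i..j}" using S1(1) S2(1) ik by (force simp: S_def)
  have st_i: "status S {i<..<j} i = (if k \<in> S then s else map_option Suc s)"
    using SL[of i] ik S1(2) by (auto simp: status_def dom_i)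
  have st_j: "status S {i<..<j} j = (if k \<in> S then t else map_option Suc t)"
    using SR[of j] ik S2(3) by (auto simp: status_def dom_j)
  have iS: "i \<in> S \<longleftrightarrow> s \<noteq> None" using SL[of i] ik S1(2) by (auto simp: status_def)
  have jS: "j \<in> S \<longleftrightarrow> t \<noteq> None" using SR[of j] ik S2(3) by (auto simp: status_def)
  have inner: "S \<inter> {i<..<j} = (S \<inter> {k}) \<union> ((S1 \<inter> {i<..<k}) \<union> (S2 \<inter> {k<..<j}))"
    unfolding split using SL SR by auto
  have cardS: "card (S \<inter> {i<..<j}) =
      of_bool (k \<in> S) + card (S1 \<inter> {i<..<k}) + card (S2 \<inter> {k<..<j})"
  proof -
    have "card ((S1 \<inter> {i<..<k}) \<union> (S2 \<inter> {k<..<j})) = card (S1 \<inter> {i<..<k}) + card (S2 \<inter> {k<..<j})"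
      by (rule card_Un_disjoint) auto
    then show ?thesis
      unfolding inner by (subst card_Un_disjoint) auto
  qed
  have other: "dominators S {i..j} v = 2" if "v \<in> S" "v \<in> {i<..<j}" "v \<noteq> k" for v
    using that SL[of v] SR[of v] S1(4)[of v] S2(4)[of v] dom_L[of v] dom_R[of v]
    by (cases "v < k") auto
  show ?thesis
  proof (cases "k \<in> S")
    case False
    then have "c = None" "c' = None"
      using S1(3) S2(2) SL[of k] SR[of k] by (auto simp: status_def)
    then have e: "e = (map_option Suc s, map_option Suc t, w + w' - 1)"
      using gl by (simp add: e1 e2)
    have "\<forall>v\<in>S \<inter> {i<..<j}. dominators S {i..j} v = 2" using other False by blast
    then show ?thesis unfolding achieves_def e
      using S_sub st_i st_j False cardS S1(5) S2(5) ik
      by (intro exI[of _ S]) auto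
  next
    case True
    then have c: "c = Some (dominators S1 {i<..<k} k)" "c' = Some (dominators S2 {k<..<j} k)"
      using S1(3) S2(2) SL[of k] SR[of k] by (auto simp: status_def)
    then have e: "e = (s, t, w + w' + 7)"
      and two: "dominators S1 {i<..<k} k + dominators S2 {k<..<j} k + of_bool (s = None) + of_bool (t = None) = 2"
      using gl by (auto simp: e1 e2 split: if_splits)
    have "dominators S {i..j} k = 2" using two dom_k iS jS by simp
    then have "\<forall>v\<in>S \<inter> {i<..<j}. dominators S {i..j} v = 2" using other by blast
    then show ?thesis unfolding achieves_def e
      using S_sub st_i st_j True cardS S1(5) S2(5) ik
      by (intro exI[of _ S]) auto
  qed
qed

text \<open>No corner lies strictly between adjacent ones, so nothing is interleaved with a side and
  saturation supplies it.\<close>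

lemma side_edge: "Suc i < n \<Longrightarrow> {i, Suc i} \<in> G"
  by (rule saturated) (auto simp: interleaved_def)

lemma root_edge: "n \<ge> 2 \<Longrightarrow> {0, n - 1} \<in> G"
  using edge_less by (intro saturated) (force simp: interleaved_def)+

text \<open>The apex is the last corner before \<open>j\<close> that is joined to \<open>i\<close>.\<close>

lemma apex:
  assumes e: "{i, j} \<in> G" and ij: "Suc i < j"
  obtains k where "i < k" "k < j" "{i, k} \<in> G" "{k, j} \<in> G"
proof -
  have jn: "j < n" using edge_less[OF e] .
  define K where "K = {k. i < k \<and> k < j \<and> {i, k} \<in> G}"
  have "Suc i \<in> K" using side_edge ij jn by (auto simp: K_def)
  moreover have "finite K" by (simp add: K_def)
  ultimately have k: "Max K \<in> K" and maxK: "\<And>x. x \<in> K \<Longrightarrow> x \<le> Max K"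
    by (auto intro: Max_in)
  define k where "k = Max K"
  have ik: "i < k" "k < j" "{i, k} \<in> G" using k by (auto simp: K_def k_def)
  have "{k, j} \<in> G"
  proof (rule saturated)
    show "k < j" "j < n" by fact+
    show "\<not> interleaved k j x y" if f: "{x, y} \<in> G" "x < y" for x y
    proof
      assume "interleaved k j x y"
      then consider "k < x" "x < j" "j < y" | "x < k" "k < y" "y < j"
        unfolding interleaved_def by blast
      then show False
      proof cases
        case 1
        then show False using noncrossing[OF e f(1)] ik by simp
      next
        \<comment> \<open>Here \<open>x = i\<close> contradicts the maximality of \<open>k\<close>,
          \<open>i < x\<close> gives a crossing with \<open>{i, k}\<close>, and \<open>x < i\<close>
          one with \<open>{i, j}\<close>.\<close>
        case 2
        have "x \<noteq> i"
        proof
          assume "x = i"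
          then have "y \<in> K" using 2 f ik by (simp add: K_def)
          then show False using 2 maxK[of y] by (simp add: k_def)
        qed
        moreover have "\<not> i < x" using 2 noncrossing[OF ik(3) f(1)] by auto
        moreover have "\<not> x < i"
          using noncrossing[of x y i j] f e 2 ik by auto
        ultimately show False by simp
      qed
    qed
  qed
  then show thesis using that ik by blast
qed

end

section \<open>The tables and their finite verification\<close>

definition edge_table :: "entry list" where
  "edge_table = [(None, None, 0), (None, Some 0, 0), (Some 0, None, 0), (Some 0, Some 0, 0)]"

text \<open>Found by computer search: starting from \<open>edge_table\<close>, tables were glued, truncated at 12 and
  weakened for as long as the family remained closed.\<close>

definition tables :: "entry list list" where
  "tables = [
    [(None, None, 12)],
    [(None, None, 11), (Some 1, None, 7)],
    [(None, None, 11), (None, Some 1, 7)],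
    [(None, None, 10), (Some 1, None, 10), (Some 1, Some 2, 6)],
    [(None, None, 10), (None, Some 1, 10), (Some 2, Some 1, 6)],
    [(None, None, 9), (Some 1, None, 9), (Some 0, Some 1, 12)],
    [(None, None, 9), (None, Some 1, 9), (Some 1, Some 0, 12)],
    [(None, None, 8), (Some 0, None, 4)],
    [(None, None, 8), (None, Some 0, 4)],
    [(None, None, 7), (None, Some 1, -1), (Some 1, None, -1), (Some 1, Some 1, -1)],
    [(None, None, 6), (Some 0, None, 6), (None, Some 1, 6), (Some 1, Some 2, -2)],
    [(None, None, 6), (None, Some 0, 6), (Some 1, None, 6), (Some 2, Some 1, -2)],
    [(None, None, 5), (Some 0, None, 12), (None, Some 1, 5), (Some 0, Some 1, 5)],
    [(None, None, 5), (None, Some 0, 12), (Some 1, None, 5), (Some 1, Some 0, 5)],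
    [(None, None, 4), (None, Some 0, 12), (Some 0, None, 12), (None, Some 1, 4), (Some 1, None, 4)]]"

text \<open>This is the induction step as a check of 16 times 16 pairs. Different entries of
  \<open>R\<close> may use different entries of \<open>P\<close> and \<open>Q\<close>, that is,
  different sets \<open>S\<close>.\<close>

lemma tables_closed:
  "\<forall>P\<in>set (edge_table # tables). \<forall>Q\<in>set (edge_table # tables). \<exists>R\<in>set tables.
     \<forall>(s, t, w)\<in>set R. \<exists>p\<in>set P. \<exists>q\<in>set Q.
       case glue p q of None \<Rightarrow> False | Some (s', t', w') \<Rightarrow> s' = s \<and> t' = t \<and> w \<le> w'"
  by code_simp

text \<open>For the chord from 0 to \<open>n - 1\<close>, the inner corners of \<open>S\<close> earn
  at least \<open>w + n - 2\<close>. Reaching \<open>n + 3\<close> takes \<open>w\<close> at least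
  5, or at least -3 if corner \<open>n - 1\<close> is in \<open>S\<close> and earns 8 more. In that
  case its single inner neighbour outside \<open>S\<close> is joined by corner 0.\<close>

lemma tables_final:
  "\<forall>R\<in>set tables. \<exists>(s, t, w)\<in>set R. 5 \<le> w \<and> s = None \<and> t = None \<or>
     -3 \<le> w \<and> s = None \<and> t = Some 1"
  by code_simp

section \<open>Induction over chords and evaluation at the whole polygon\<close>

context triangulated_polygon
begin

lemma achieves_mono:
  assumes "achieves i j (s, t, w')" "w \<le> w'"
  shows "achieves i j (s, t, w)"
proof -
  obtain S where "S \<subseteq> {i..j}" "status S {i<..<j} i = s" "status S {i<..<j} j = t"
    "\<forall>v \<in> S \<inter> {i<..<j}. dominators S {i..j} v = 2"
    "w' + int (j - i) \<le> 8 * int (card (S \<inter> {i<..<j})) + 1"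
    using assms(1) unfolding achieves_def by auto
  then show ?thesis
    using assms(2) unfolding achieves_def by (intro exI[of _ S]) auto
qed

lemma achieves_side:
  assumes "e \<in> set edge_table"
  shows "achieves i (Suc i) e"
proof -
  have *: "\<exists>S\<subseteq>{i..Suc i}. (i \<in> S \<longleftrightarrow> a) \<and> (Suc i \<in> S \<longleftrightarrow> b)" for a b
    by (rule exI[of _ "(if a then {i} else {}) \<union> (if b then {Suc i} else {})"]) auto
  have "{i<..<Suc i} = {}" by auto
  then show ?thesis
    using assms *[of True True] *[of True False] *[of False True] *[of False False]
    by (auto simp: edge_table_def achieves_def status_def dominators_def)
qed

text \<open>Induction on \<open>j - i\<close>, cutting at the apex; a part that is a single side
  uses \<open>edge_table\<close> instead.\<close>

lemma achieves_table:
  assumes "{i, j} \<in> G" "Suc i < j"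
  shows "\<exists>R\<in>set tables. \<forall>e\<in>set R. achieves i j e"
  using assms
proof (induction "j - i" arbitrary: i j rule: less_induct)
  case less
  obtain k where k: "i < k" "k < j" "{i, k} \<in> G" "{k, j} \<in> G"
    using apex[OF less.prems] .
  have part: "\<exists>R\<in>set (edge_table # tables). \<forall>e\<in>set R. achieves a b e"
    if "{a, b} \<in> G" "a < b" "b - a < j - i" for a b
  proof (cases "b = Suc a")
    case True
    then show ?thesis using achieves_side by auto
  next
    case False
    then show ?thesis using less.hyps[of b a] that by auto
  qed
  obtain P where P: "P \<in> set (edge_table # tables)" "\<And>e. e \<in> set P \<Longrightarrow> achieves i k e"
    using part[of i k] k by (metis diff_less_mono less_imp_le)
  obtain Q where Q: "Q \<in> set (edge_table # tables)" "\<And>e. e \<in> set Q \<Longrightarrow> achieves k j e"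
    using part[of k j] k by (metis diff_less_mono2 less_trans)
  obtain R where R: "R \<in> set tables" and dominated: "\<forall>(s, t, w)\<in>set R. \<exists>p\<in>set P. \<exists>q\<in>set Q.
       case glue p q of None \<Rightarrow> False | Some (s', t', w') \<Rightarrow> s' = s \<and> t' = t \<and> w \<le> w'"
    using tables_closed P(1) Q(1) by blast
  have "achieves i j (s, t, w)" if e: "(s, t, w) \<in> set R" for s t w
  proof -
    have "\<exists>p\<in>set P. \<exists>q\<in>set Q.
       case glue p q of None \<Rightarrow> False | Some (s', t', w') \<Rightarrow> s' = s \<and> t' = t \<and> w \<le> w'"
      using bspec[OF dominated e] by simp
    then obtain p q where pq: "p \<in> set P" "q \<in> set Q"
      "case glue p q of None \<Rightarrow> False | Some (s', t', w') \<Rightarrow> s' = s \<and> t' = t \<and> w \<le> w'"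
      by blast
    then obtain w' where w': "glue p q = Some (s, t, w')" "w \<le> w'"
      by (auto split: option.splits)
    have "achieves i j (s, t, w')"
      using achieves_glue[OF k(1,2) less.prems(1) k(3,4) P(2) Q(2) w'(1)] pq by blast
    then show ?thesis using w'(2) by (rule achieves_mono)
  qed
  then show ?case using R by (metis prod_cases3)
qed

text \<open>The side from 0 to \<open>n - 1\<close> cuts off the whole polygon, so its table can be
  read off.\<close>

lemma exists_large_fair_complement:
  assumes "n \<ge> 3"
  obtains S where "S \<subseteq> {..<n}" "n + 3 \<le> 8 * card S"
    "\<And>v. v \<in> S \<Longrightarrow> card {u \<in> {..<n} - S. {u, v} \<in> G} = 2"
proof -
  define m where "m = n - 1"
  have m: "Suc 0 < m" "n = Suc m" using assms by (simp_all add: m_def)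
  have root: "{0, m} \<in> G" "{m, 0} \<in> G"
    using root_edge m by (simp_all add: insert_commute)
  obtain R where R: "R \<in> set tables" "\<And>e. e \<in> set R \<Longrightarrow> achieves 0 m e"
    using achieves_table[OF root(1) m(1)] by blast
  obtain s t w where "(s, t, w) \<in> set R"
    and st: "5 \<le> w \<and> s = None \<and> t = None \<or> -3 \<le> w \<and> s = None \<and> t = Some 1"
    using tables_final R(1) by blast
  then have "achieves 0 m (s, t, w)" using R(2) by blast
  then obtain S where S: "S \<subseteq> {0..m}" "status S {0<..<m} 0 = s" "status S {0<..<m} m = t"
    "\<And>v. v \<in> S \<Longrightarrow> v \<in> {0<..<m} \<Longrightarrow> dominators S {0..m} v = 2"
    "w + int m \<le> 8 * int (card (S \<inter> {0<..<m})) + 1"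
    unfolding achieves_def by auto
  have all: "{..<n} = {0..m}" using m by auto
  have split: "{0..m} = insert 0 (insert m {0<..<m})" using m by auto
  have 0: "0 \<notin> S" using S(2) st by (auto simp: status_def)
  have dom: "dominators S {0..m} v = 2" if "v \<in> S" for v
  proof (cases "v = m")
    case True
    \<comment> \<open>Only the second alternative of \<open>tables_final\<close> puts
      \<open>m\<close> into \<open>S\<close>; corner 0 is then its second neighbour outside
      \<open>S\<close>.\<close>
    then have "dominators S {0<..<m} v = 1" using that S(3) st by (auto simp: status_def)
    then show ?thesis
      using True that 0 root no_loop[of m] m(1) by (simp add: split dominators_insert)
  next
    case False
    then show ?thesis using that S(1,4) 0 by (cases "v = 0") force+
  qed
  have inner: "S = (S \<inter> {m}) \<union> (S \<inter> {0<..<m})" using S(1) 0 split by auto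
  have "card S = card (S \<inter> {m}) + card (S \<inter> {0<..<m})"
    by (subst inner, rule card_Un_disjoint) auto
  moreover have "card (S \<inter> {m}) = of_bool (m \<in> S)" by simp
  moreover have "m \<in> S \<longleftrightarrow> t \<noteq> None" using S(3) by (auto simp: status_def split: if_splits)
  ultimately have "n + 3 \<le> 8 * card S" using st S(5) m by auto
  moreover have "card {u \<in> {..<n} - S. {u, v} \<in> G} = 2" if "v \<in> S" for v
  proof -
    have "card {u \<in> {..<n} - S. {u, v} \<in> G} = dominators S {..<n} v"
      by (simp add: dominators_def of_bool_def sum.If_cases Int_def set_diff_eq conj_assoc lessThan_def)
    then show ?thesis using dom[OF that] all by simp
  qed
  ultimately show thesis using that[of S] S(1) all by simp
qed

end

section \<open>Transfer to the abstract graph\<close>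

lemma fair_domination_number_le:
  assumes "fair_dominating_set V E D"
  shows "fair_domination_number V E \<le> card D"
  unfolding fair_domination_number_def using assms by (blast intro: Least_le)

theorem theorem13:
  fixes V :: "'a set" and E :: "'a set set" and n :: nat
  assumes "maximal_outerplanar V E"
    and "card V = n"
    and "n \<ge> 3"
  shows "real (fair_domination_number V E) \<le> (7 * real n - 3) / 8
       \<and> (7 * real n - 3) / 8 < 7 * real n / 8"
proof -
  obtain p c T where conv: "convex_polygon n p" and bij: "bij_betw c {..<n} V"
    and tri: "triangulating_diagonals n p T"
    and E: "E = (\<lambda>e. c ` e) ` (polygon_sides n \<union> T)"
    using assms(1) unfolding maximal_outerplanar_def assms(2) by blast
  define G where "G = polygon_sides n \<union> T"
  interpret triangulated_polygon n G
    unfolding G_def using conv tri by (rule triangulating_diagonals_imp_triangulated_polygon)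
  obtain S where S: "S \<subseteq> {..<n}" "n + 3 \<le> 8 * card S"
    "\<And>v. v \<in> S \<Longrightarrow> card {u \<in> {..<n} - S. {u, v} \<in> G} = 2"
    using exists_large_fair_complement assms(3) by blast
  have inj: "inj_on c {..<n}" and V: "V = c ` {..<n}"
    using bij by (auto simp: bij_betw_def)
  define D where "D = c ` ({..<n} - S)"
  have VD: "V - D = c ` S"
    unfolding V D_def using inj S(1) by (subst inj_on_image_set_diff[symmetric, OF inj]) (auto simp: double_diff)
  have edge_iff: "{c u, c v} \<in> E \<longleftrightarrow> {u, v} \<in> G" if "u < n" "v < n" for u v
  proof
    assume "{c u, c v} \<in> E"
    then obtain e where e: "e \<in> G" "{c u, c v} = c ` e" by (auto simp: E G_def)
    \<comment> \<open>Injectivity of \<open>c\<close> is known on the corners only, so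
      \<open>e\<close> must first be placed there.\<close>
    have "e \<subseteq> {..<n}"
      using e(1) tri by (auto simp: G_def polygon_sides_def triangulating_diagonals_def
          noncrossing_diagonals_def polygon_diagonals_def)
    moreover have "c ` {u, v} = c ` e" using e(2) by simp
    ultimately have "{u, v} = e"
      using inj_on_image_eq_iff[OF inj, of "{u, v}" e] that by auto
    then show "{u, v} \<in> G" using e(1) by simp
  next
    assume "{u, v} \<in> G"
    then have "c ` {u, v} \<in> E" unfolding E G_def by blast
    then show "{c u, c v} \<in> E" by simp
  qed
  have two: "card (neighborhood V E x \<inter> D) = 2" if x: "x \<in> V - D" for x
  proof -
    obtain v where v: "v \<in> S" "x = c v" using x VD by blast
    have "neighborhood V E x \<inter> D = c ` {u \<in> {..<n} - S. {u, v} \<in> G}"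
      using v S(1) edge_iff by (auto simp: neighborhood_def D_def V)
    moreover have "inj_on c {u \<in> {..<n} - S. {u, v} \<in> G}"
      using inj by (rule inj_on_subset) auto
    ultimately show ?thesis using S(3)[OF v(1)] by (simp add: card_image)
  qed
  \<comment> \<open>The common value two gives fairness and, being nonzero, domination.\<close>
  have "\<exists>u\<in>D. u \<in> neighborhood V E x" if "x \<in> V - D" for x
  proof -
    have "neighborhood V E x \<inter> D \<noteq> {}" using two[OF that] by auto
    then show ?thesis by blast
  qed
  then have "fair_dominating_set V E D"
    using two by (auto simp: fair_dominating_set_def dominating_set_def D_def V)
  then have "fair_domination_number V E \<le> card D"
    by (rule fair_domination_number_le)
  also have "card D = n - card S"
    using inj_on_subset[OF inj, of "{..<n} - S"] S(1)
    by (simp add: D_def card_image card_Diff_subset finite_subset)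
  finally have "8 * fair_domination_number V E + 3 \<le> 7 * n"
    using S(2) assms(3) by linarith
  then have "8 * real (fair_domination_number V E) + 3 \<le> 7 * real n"
    by linarith
  then show ?thesis by simp
qed

end
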